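(* Let $k$ be a positive integer and $t=2^{2k}-2^k+1$. Let $$\phi_t(x,y)=\prod_{\alpha\in\mathbb{F}_{2^k}\setminus\mathbb{F}_2}P_\alpha(x,y)$$ be the factorization of $\phi_t(x,y)$ into absolutely irreducible components $P_\alpha\in\mathbb{F}_{2^k}[x,y]$ of degree $2^k+1$ with $P_\alpha(x,0)=(x+\alpha)^{2^k+1}$. Then the components $P_\alpha(x,y)$, $\alpha\in\mathbb{F}_{2^k}\setminus\mathbb{F}_2$, intersect transversally at the point $p=(1,1)$.
   Context: All polynomials are over fields of characteristic 2. For an integer $j\ge 3$, put $$\phi_j(x,y,z)=\frac{x^j+y^j+z^j+(x+y+z)^j}{(x+y)(x+z)(y+z)},\qquad \phi_j(x,y)=\phi_j(x,y,1),$$ which are polynomials with coefficients in $\mathbb{F}_2$. Known fact (Janwa and Wilson): for $t=2^{2k}-2^k+1$ one has $\phi_t(x,y)=\prod_{\alpha\in\mathbb{F}_{2^k}\setminus\mathbb{F}_2}P_\alpha(x,y)$, where each $P_\alpha\in\mathbb{F}_{2^k}[x,y]$ is absolutely irreducible (irreducible over $\overline{\mathbb{F}}_2$) of degree $2^k+1$ and satisfies $P_\alpha(x,0)=(x+\alpha)^{2^k+1}$. Plane curves $f_i(x,y)=0$ are said to intersect transversally at a point $p$ if $p$ is a simple point of each $f_i$ (in particular $f_i(p)=0$ for every $i$) and the tangent lines to the curves $f_i$ at $p$ are pairwise distinct. *)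

theory Defs
  imports "HOL-Algebra.Algebraic_Closure_Type"
begin

hide_const (open) Divisibility.prime Divisibility.irreducible

text \<open>
  A polynomial in \<open>x, y\<close> over \<open>'a\<close> is an element of \<open>'a poly poly\<close>: the outer variable is
  \<open>y\<close> and the coefficients are polynomials in \<open>x\<close>. Thus \<open>poly p 0\<close> is \<open>p(x,0)\<close> and
  \<open>poly (poly p [:b:]) a\<close> is \<open>p(a,b)\<close>. For three variables, \<open>z\<close> is the outermost one, and
  \<open>poly p 1\<close> is \<open>p(x,y,1)\<close>.
\<close>

definition varX :: "'a::comm_ring_1 poly poly poly" where
  "varX = [:[:[:0, 1:]:]:]"

definition varY :: "'a::comm_ring_1 poly poly poly" where
  "varY = [:[:0, 1:]:]"

definition varZ :: "'a::comm_ring_1 poly poly poly" where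
  "varZ = [:0, 1:]"

definition phi_num :: "nat \<Rightarrow> 'a::field poly poly poly" where
  "phi_num j = varX ^ j + varY ^ j + varZ ^ j + (varX + varY + varZ) ^ j"

definition phi_den :: "'a::field poly poly poly" where
  "phi_den = (varX + varY) * (varX + varZ) * (varY + varZ)"

text \<open>
  The division in \<open>phi3\<close> is exact in characteristic 2 (see \<open>phi3_exact\<close> below); in other
  characteristics \<open>phi3\<close> has no meaning.
\<close>

definition phi3 :: "nat \<Rightarrow> 'a::field poly poly poly" where
  "phi3 j = phi_num j div phi_den"

definition phi :: "nat \<Rightarrow> 'a::field poly poly" where
  "phi j = poly (phi3 j) 1"

definition total_degree :: "'a::zero poly poly \<Rightarrow> nat" where
  "total_degree p =
     (if p = 0 then 0
      else Max {i + Polynomial.degree (Polynomial.coeff p i) | i. Polynomial.coeff p i \<noteq> 0})"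

definition base_change :: "'a::field poly poly \<Rightarrow> 'a alg_closure poly poly" where
  "base_change = map_poly (map_poly to_ac)"

definition absolutely_irreducible :: "'a::field poly poly \<Rightarrow> bool" where
  "absolutely_irreducible p \<longleftrightarrow> Factorial_Ring.irreducible (base_change p)"

definition eval2 :: "'a::comm_ring_1 poly poly \<Rightarrow> 'a \<times> 'a \<Rightarrow> 'a" where
  "eval2 p = (\<lambda>(a, b). poly (poly p [:b:]) a)"

definition pderiv_x :: "'a::idom poly poly \<Rightarrow> 'a poly poly" where
  "pderiv_x p = map_poly pderiv p"

definition pderiv_y :: "'a::idom poly poly \<Rightarrow> 'a poly poly" where
  "pderiv_y p = pderiv p"

definition simple_point :: "'a::field poly poly \<Rightarrow> 'a \<times> 'a \<Rightarrow> bool" where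
  "simple_point f p \<longleftrightarrow>
     eval2 f p = 0 \<and> (eval2 (pderiv_x f) p \<noteq> 0 \<or> eval2 (pderiv_y f) p \<noteq> 0)"

definition tangent_line :: "'a::field poly poly \<Rightarrow> 'a \<times> 'a \<Rightarrow> ('a \<times> 'a) set" where
  "tangent_line f p =
     {(u, v). eval2 (pderiv_x f) p * (u - fst p) + eval2 (pderiv_y f) p * (v - snd p) = 0}"

definition intersect_transversally ::
    "'i set \<Rightarrow> ('i \<Rightarrow> 'a::field poly poly) \<Rightarrow> 'a \<times> 'a \<Rightarrow> bool" where
  "intersect_transversally I f p \<longleftrightarrow>
     (\<forall>i\<in>I. simple_point (f i) p) \<and>
     (\<forall>i\<in>I. \<forall>j\<in>I. i \<noteq> j \<longrightarrow> tangent_line (f i) p \<noteq> tangent_line (f j) p)"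

lemma prime_elem_linear:
  fixes a :: "'a::idom"
  shows "prime_elem [:a, 1:]"
proof -
  have "[:a, 1:] dvd p \<longleftrightarrow> poly p (- a) = 0" for p
    using poly_eq_0_iff_dvd[of p "- a"] by simp
  then show ?thesis
    by (auto simp: prime_elem_def is_unit_pCons_iff)
qed

lemma phi3_exact:
  assumes "CHAR('a::field) = 2"
  shows "phi3 j * phi_den = (phi_num j :: 'a poly poly poly)"
proof -
  have char2: "u + u = 0" for u :: "'a poly poly poly"
  proof -
    have "CHAR('a poly poly poly) = 2" using assms by simp
    then have "(of_nat 2 :: 'a poly poly poly) = 0" using of_nat_CHAR by metis
    then show ?thesis by (simp flip: mult_2)
  qed
  have minus: "u - v = u + v" for u v :: "'a poly poly poly"
    using char2[of v] eq_neg_iff_add_eq_0[of v v] by (metis diff_conv_add_uminus)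
  have pow: "u + v dvd u ^ j + v ^ j" for u v :: "'a poly poly poly"
  proof -
    have "u - v dvd u ^ j - v ^ j"
      by (simp add: power_diff_sumr2)
    then show ?thesis by (simp only: minus)
  qed
  define a b c :: "'a poly poly poly" where "a = varX" and "b = varY" and "c = varZ"
  note defs = this
  let ?N = "a ^ j + b ^ j + c ^ j + (a + b + c) ^ j"
  have d: "u + v dvd u ^ j + v ^ j + w ^ j + (u + v + w) ^ j" for u v w :: "'a poly poly poly"
  proof -
    have "w + (u + v + w) = u + v" using char2[of w] by (simp add: algebra_simps)
    then have "u + v dvd w ^ j + (u + v + w) ^ j" using pow[of w "u + v + w"] by metis
    from dvd_add[OF pow[of u v] this] show ?thesis by (simp only: add.assoc)
  qed
  have dab: "a + b dvd ?N" using d[of a b c] by simp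
  have dac: "a + c dvd ?N" using d[of a c b] by (simp only: ac_simps)
  have dbc: "b + c dvd ?N" using d[of b c a] by (simp only: ac_simps)
  have ab: "a + b = [:[:[:0, 1:], 1:]:]" and ac: "a + c = [:[:[:0, 1:]:], 1:]"
    and bc: "b + c = [:[:0, 1:], 1:]"
    by (simp_all add: defs varX_def varY_def varZ_def)
  have pbc: "prime_elem (b + c)" and pac: "prime_elem (a + c)" and pab: "prime_elem (a + b)"
    unfolding ab ac bc by (intro prime_elem_linear lift_prime_elem_poly)+
  have nconst: "\<not> a + b dvd [:u, 1:]" for u :: "'a poly poly"
  proof
    assume "a + b dvd [:u, 1:]"
    then have "[:[:0, 1:], 1:] dvd Polynomial.coeff [:u, 1:] 1"
      unfolding ab const_poly_dvd_iff by blast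
    then have "is_unit [:[:0::'a, 1:], 1:]" by simp
    then show False using prime_elem_linear[of "[:0::'a, 1:]"] by (simp only: prime_elem_not_unit)
  qed
  have n1: "\<not> a + b dvd a + c" and n2: "\<not> a + b dvd b + c"
    using nconst ac bc by metis+
  have n3: "\<not> a + c dvd b + c"
    unfolding ac bc using poly_eq_0_iff_dvd[of "[:[:0, 1:], 1:]" "- [:[:0::'a, 1:]:]"] by simp
  obtain q where q: "?N = (b + c) * q" using dbc by blast
  have "a + c dvd q" using prime_elem_dvd_mult_iff[OF pac] n3 dac q by metis
  then obtain r where r: "q = (a + c) * r" by blast
  have "a + b dvd r" using prime_elem_dvd_mult_iff[OF pab] n1 n2 dab q r by metis
  then obtain s where s: "r = (a + b) * s" by blast
  have "phi_num j = phi_den * s"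
    unfolding phi_num_def phi_den_def using q unfolding r s defs by (simp only: ac_simps)
  then show ?thesis unfolding phi3_def by (metis dvd_div_mult_self dvd_triv_left)
qed

end

theory Submission
  imports Defs
begin

text \<open>
  Write \<open>q = 2 ^ k\<close> and let \<open>c\<close> be the square root of \<open>\<alpha>\<close> in \<open>\<bbbF>\<^sub>q\<close>. The idea is that
  each component \<open>P \<alpha>\<close> contains an explicit rational curve through \<open>(1, 1)\<close>, namely
  \<open>s \<mapsto> ((1 + (1 + c) s) ^ (q + 1), (1 + s) ^ (q + 1))\<close>.

  For elements \<open>a\<close> of \<open>\<bbbF>\<^sub>q\<close> one has \<open>(1 + a s) ^ (q + 1) = 1 + a (s + s ^ q) + a\<^sup>2 s ^ (q + 1)\<close>, and
  summing this over \<open>a = 0, 1, c, 1 + c\<close> gives \<open>0\<close> in characteristic 2. Hence on the curve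
  \<open>x + y + 1 = (1 + c s) ^ (q + 1)\<close>. Since \<open>t (q + 1) = q ^ 3 + 1\<close>, the four \<open>t\<close>-th powers in the
  numerator of \<open>phi t\<close> become \<open>(1 + a s) ^ (q ^ 3 + 1)\<close>, and these sum to \<open>0\<close> by the same
  computation with \<open>q ^ 3\<close> in place of \<open>q\<close>. So \<open>phi t\<close> vanishes along the curve
  (\<open>phi_along_curve\<close>), and therefore so does one of its factors. At \<open>s = 1\<close> the curve passes through
  \<open>(\<alpha>, 0)\<close>, and among all components only \<open>P \<alpha>\<close> contains that point, because
  \<open>P \<beta>\<close> restricts to \<open>(x + \<beta>) ^ (q + 1)\<close> on \<open>y = 0\<close>. So the factor is \<open>P \<alpha>\<close>.

  At \<open>s = 0\<close> the curve is at \<open>(1, 1)\<close> with velocity \<open>(1 + c, 1)\<close>. This shows that \<open>P \<alpha>\<close> vanishes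
  at \<open>(1, 1)\<close>, and that its tangent there, if the point is simple, has this direction; as \<open>c\<close>
  determines \<open>\<alpha>\<close>, the tangents are then distinct.

  Simplicity is a count of multiplicities on the line \<open>y = 1\<close>. There
  \<open>phi t\<close> times \<open>(x + 1)\<^sup>2\<close> is \<open>(1 + x ^ (q - 1)) ^ q\<close> (\<open>phi_line_y_1\<close>), which has a zero of order
  exactly \<open>q\<close> at \<open>x = 1\<close>. So the \<open>q - 2\<close> components, all of which vanish
  at \<open>x = 1\<close>, have total order \<open>q - 2\<close>, and each vanishes to order exactly one. In particular
  the \<open>x\<close>-derivative of each is nonzero at \<open>(1, 1)\<close>.
\<close>

section \<open>Finite fields of even order\<close>

text \<open>
  Multiplication by \<open>b\<close> permutes the nonzero elements, so it leaves their product unchanged;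
  it also multiplies that product by \<open>b\<close> once for every nonzero element.
\<close>

lemma power_card_field:
  fixes b :: "'f::{field, finite}"
  shows "b ^ card (UNIV :: 'f set) = b"
proof (cases "b = 0")
  case True
  then show ?thesis by (simp add: zero_power finite_UNIV_card_ge_0)
next
  case False
  let ?U = "UNIV - {0 :: 'f}"
  have "bij_betw ((*) b) ?U ?U"
    by (rule bij_betwI[of _ _ _ "\<lambda>y. y / b"]) (use False in auto)
  then have "(\<Prod>y\<in>?U. b * y) = \<Prod>?U"
    by (rule prod.reindex_bij_betw)
  then have "b ^ card ?U * \<Prod>?U = \<Prod>?U"
    by (simp add: prod.distrib)
  then have "b ^ card ?U = 1" by simp
  moreover have "card (UNIV :: 'f set) = Suc (card ?U)"
    by (metis card.remove finite UNIV_I)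
  ultimately show ?thesis by (metis mult.right_neutral power_Suc)
qed

text \<open>
  The \<open>q\<close>-th power fixes \<open>- 1\<close>, but for even \<open>q\<close> it also sends \<open>- 1\<close> to \<open>1\<close>.
\<close>

lemma CHAR_eq_2_if_even_card:
  assumes "even (card (UNIV :: 'f::{field, finite} set))"
  shows "CHAR('f) = 2"
proof -
  have "(- 1 :: 'f) = 1"
    using power_card_field[of "- 1 :: 'f"] assms by simp
  then have "(of_nat 2 :: 'f) = 0"
    by (metis add.right_inverse of_nat_numeral one_add_one)
  then have "CHAR('f) dvd 2" by (simp only: of_nat_eq_0_iff_char_dvd)
  moreover have "CHAR('f) \<noteq> 1" by simp
  ultimately show ?thesis
    by (metis prime_nat_iff two_is_prime_nat)
qed

lemma square_root_exists_CHAR_2: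
  fixes a :: "'f::{field, finite}"
  assumes "CHAR('f) = 2"
  shows "\<exists>c. a = c ^ 2"
proof -
  have "inj (\<lambda>c :: 'f. c ^ 2)"
    using assms by (auto intro!: injI simp: power2_eq_iff uminus_CHAR_2)
  then have "surj (\<lambda>c :: 'f. c ^ 2)"
    by (intro finite_UNIV_inj_surj finite)
  then show ?thesis by (rule surjD)
qed

lemma add_self_CHAR_2:
  assumes "CHAR('a::comm_ring_1) = 2"
  shows "u + u = (0 :: 'a)"
  using uminus_CHAR_2[OF assms, of u] by (metis add.right_inverse)

section \<open>The equation of the curve\<close>

text \<open>
  The exact division that defines \<open>phi\<close>, set to \<open>z = 1\<close>: this is the form in which \<open>phi\<close> is
  accessible to substitution and differentiation.
\<close>

lemma phi_times_lines:
  assumes "CHAR('a::field) = 2"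
  defines "x \<equiv> [:[:0, 1:]:] :: 'a poly poly" and "y \<equiv> [:0, 1:]"
  shows "phi j * ((x + y) * (x + 1) * (y + 1)) = x ^ j + y ^ j + 1 + (x + y + 1) ^ j"
proof -
  have "poly (phi3 j * phi_den) 1 = poly (phi_num j :: 'a poly poly poly) 1"
    using phi3_exact[OF assms(1)] by (simp only:)
  moreover have "poly varX 1 = x" "poly varY 1 = y" "poly varZ 1 = (1 :: 'a poly poly)"
    by (simp_all add: varX_def varY_def varZ_def x_def y_def)
  ultimately show ?thesis
    by (simp add: phi_def phi_den_def phi_num_def poly_power)
qed

text \<open>
  Both sides of \<open>phi_times_lines\<close> vanish on the line \<open>y = 1\<close>. Taking the \<open>y\<close>-derivative there
  removes the factor \<open>y + 1\<close>, because \<open>y + 1\<close> is \<open>0\<close> at \<open>y = 1\<close> in characteristic 2. The other two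
  factors of the denominator both restrict to \<open>x + 1\<close>.
\<close>

lemma phi_line_y_1:
  assumes "CHAR('a::field) = 2" and "odd t"
  shows "poly (phi t) 1 * [:1, 1:] ^ 2 = (1 + [:0, 1:] ^ (t - 1) :: 'a poly)"
proof -
  define x where "x = ([:[:0, 1:]:] :: 'a poly poly)"
  define y where "y = ([:0, 1:] :: 'a poly poly)"
  have two: "(1 + 1 :: 'a poly) = 0"
    using assms(1) by (intro add_self_CHAR_2) simp
  have dx: "pderiv x = 0" and dy: "pderiv y = 1" and vx: "poly x 1 = [:0, 1:]" and vy: "poly y 1 = 1"
    by (simp_all add: x_def y_def pderiv_pCons)
  have t: "of_nat t = (1 :: 'a poly)"
    using assms(2) two by (auto elim!: oddE)
  have "pderiv (phi t * ((x + y) * (x + 1) * (y + 1))) = pderiv (x ^ t + y ^ t + 1 + (x + y + 1) ^ t)"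
    unfolding x_def y_def by (simp only: phi_times_lines[OF assms(1)])
  from arg_cong[OF this, of "\<lambda>f. poly f 1"]
  have "poly (phi t) 1 * (([:0, 1 :: 'a:] + 1) * ([:0, 1:] + 1)) = 1 + [:0, 1:] ^ (t - 1)"
    by (simp add: pderiv_mult pderiv_add pderiv_power dx dy vx vy two poly_power t add.assoc del: one_add_one)
  moreover have "[:0, 1:] + 1 = [:1 :: 'a, 1:]" by (simp add: one_pCons)
  ultimately show ?thesis
    by (simp only: power2_eq_square)
qed

section \<open>Substituting a parametrized curve\<close>

text \<open>
  The polynomial \<open>f(U(s), V(s))\<close> in the curve parameter \<open>s\<close>. Keeping it a polynomial, rather than a
  family of values, gives an integral domain to argue in and a derivative with respect to \<open>s\<close>.
\<close>

definition along :: "'a::idom poly \<Rightarrow> 'a poly \<Rightarrow> 'a poly poly \<Rightarrow> 'a poly" where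
  "along U V f = poly (map_poly (\<lambda>c. pcompose c U) f) V"

lemma along_0 [simp]: "along U V 0 = 0"
  by (simp add: along_def)

lemma along_pCons: "along U V (pCons c f) = pcompose c U + V * along U V f"
  by (simp add: along_def map_poly_pCons)

lemma along_1 [simp]: "along U V 1 = 1"
  by (simp add: along_pCons one_pCons pcompose_1)

lemma along_add: "along U V (f + g) = along U V f + along U V g"
proof (induction f arbitrary: g)
  case (pCons c f)
  show ?case
    by (cases g) (simp add: along_pCons pcompose_add pCons.IH, simp add: algebra_simps)
qed simp

lemma along_smult: "along U V (smult c f) = pcompose c U * along U V f"
  by (induction f) (simp_all add: along_pCons pcompose_mult algebra_simps)

lemma along_mult: "along U V (f * g) = along U V f * along U V g"
  by (induction f) (simp_all add: along_pCons along_add along_smult algebra_simps)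

lemma along_power: "along U V (f ^ n) = along U V f ^ n"
  by (induction n) (simp_all add: along_mult)

lemma along_prod: "along U V (prod f A) = (\<Prod>a\<in>A. along U V (f a))"
  by (induction A rule: infinite_finite_induct) (simp_all add: along_mult)

lemma poly_along: "poly (along U V f) s = eval2 f (poly U s, poly V s)"
  by (induction f) (simp_all add: along_pCons eval2_def poly_pcompose)

text \<open>
  The chain rule; it turns the velocity of a curve inside \<open>f = 0\<close> into a tangent vector of \<open>f = 0\<close>.
\<close>

lemma pderiv_along:
  "pderiv (along U V f) = along U V (pderiv_x f) * pderiv U + along U V (pderiv_y f) * pderiv V"
proof (induction f)
  case (pCons c f)
  have "pderiv_x (pCons c f) = pCons (pderiv c) (pderiv_x f)"
    by (simp add: pderiv_x_def map_poly_pCons)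
  moreover have "pderiv_y (pCons c f) = f + pCons 0 (pderiv_y f)"
    by (simp add: pderiv_y_def pderiv_pCons)
  ultimately show ?case
    by (simp add: along_pCons along_add pderiv_add pderiv_mult pderiv_pcompose pCons.IH algebra_simps)
qed (simp add: pderiv_x_def pderiv_y_def)

section \<open>A rational curve on each component\<close>

lemma kasami_exponent:
  fixes q :: nat
  assumes "q > 0"
  shows "(q + 1) * (q ^ 2 - q + 1) = q ^ 3 + 1" and "q ^ 2 - q = (q - 1) * q"
proof -
  obtain m where "q = Suc m" using assms by (cases q) auto
  then show "(q + 1) * (q ^ 2 - q + 1) = q ^ 3 + 1" and "q ^ 2 - q = (q - 1) * q"
    by (simp_all add: power2_eq_square power3_eq_cube algebra_simps)
qed

text \<open>
  Since \<open>b\<close> is fixed by the \<open>2 ^ m\<close>-th power map, which is additive, the result is a quadratic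
  polynomial in \<open>b\<close> whose coefficients do not depend on \<open>b\<close>.
\<close>

lemma linear_power_Suc:
  fixes b :: "'a::field"
  assumes "CHAR('a) = 2" and "b ^ (2 ^ m) = b"
  shows "[:1, b:] ^ (2 ^ m + 1)
    = 1 + smult b ([:0, 1:] + [:0, 1:] ^ (2 ^ m)) + smult (b ^ 2) ([:0, 1:] ^ (2 ^ m + 1))"
proof -
  define s where "s = ([:0, 1:] :: 'a poly)"
  have lin: "[:1, b:] = 1 + smult b s" by (simp add: one_pCons s_def)
  have "(1 + smult b s) ^ (2 ^ m) = 1 + smult b (s ^ (2 ^ m))"
    using freshmans_dream'[where ?'a = "'a poly" and x = 1 and y = "smult b s" and m = "2 ^ m" and n = m]
      assms by (simp add: smult_power)
  then show ?thesis
    unfolding lin s_def[symmetric] by (simp add: algebra_simps power2_eq_square smult_add_right)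
qed

text \<open>
  By \<open>linear_power_Suc\<close> the summands are the values of one quadratic polynomial at
  \<open>1 + c\<close>, \<open>1\<close>, \<open>0\<close> and \<open>c\<close>. These four elements sum to \<open>0\<close>,
  and so do their squares because squaring is additive. The lemma is used with \<open>2 ^ m = q\<close> to compute \<open>x + y + 1\<close> on the curve, and with \<open>2 ^ m = q ^ 3\<close> to show that
  the numerator of \<open>phi t\<close> vanishes there.
\<close>

lemma kasami_sum_eq_0:
  fixes c :: "'a::field"
  assumes "CHAR('a) = 2" and "c ^ (2 ^ m) = c"
  shows "[:1, 1 + c:] ^ (2 ^ m + 1) + [:1, 1:] ^ (2 ^ m + 1) + 1 + [:1, c:] ^ (2 ^ m + 1) = 0"
proof -
  let ?s = "[:0, 1:] :: 'a poly"
  have two: "u + u = 0" for u :: "'a poly"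
    using assms(1) by (intro add_self_CHAR_2) simp
  have c1: "(1 + c) ^ (2 ^ m) = 1 + c"
    using freshmans_dream'[where ?'a = 'a and x = 1 and y = c and m = "2 ^ m" and n = m] assms by simp
  have sq: "(1 + c) ^ 2 = 1 + c ^ 2"
    by (subst freshmans_dream) (simp_all add: assms(1))
  define u where "u = ?s + ?s ^ (2 ^ m)"
  define v where "v = ?s ^ (2 ^ m + 1)"
  have e1: "[:1, 1 + c:] ^ (2 ^ m + 1) = 1 + smult (1 + c) u + smult (1 + c ^ 2) v"
    using linear_power_Suc[OF assms(1) c1] unfolding u_def v_def sq .
  have e2: "[:1, 1:] ^ (2 ^ m + 1) = 1 + u + v"
    using linear_power_Suc[of 1 m] assms(1) unfolding u_def v_def by simp
  have e3: "[:1, c:] ^ (2 ^ m + 1) = 1 + smult c u + smult (c ^ 2) v"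
    using linear_power_Suc[OF assms] unfolding u_def v_def .
  have "[:1, 1 + c:] ^ (2 ^ m + 1) + [:1, 1:] ^ (2 ^ m + 1) + 1 + [:1, c:] ^ (2 ^ m + 1)
    = (1 + 1) + (1 + 1) + (u + u) + (v + v) + (smult c u + smult c u) + (smult (c ^ 2) v + smult (c ^ 2) v)"
    unfolding e1 e2 e3 by (simp add: smult_add_left algebra_simps del: one_add_one)
  then show ?thesis by (simp only: two add_0_left)
qed

text \<open>
  The excluded values of \<open>c\<close> are those for which the curve lies on one of the lines
  \<open>x = y\<close> (for \<open>c = 0\<close>) and \<open>x = 1\<close> (for \<open>c = 1\<close>), where the denominator of \<open>phi t\<close> vanishes.
\<close>

lemma phi_along_curve:
  fixes c :: "'f::{field, finite}"
  assumes "k > 0" and card: "card (UNIV :: 'f set) = 2 ^ k" and t: "t = 2 ^ (2 * k) - 2 ^ k + 1"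
    and c: "c \<noteq> 0" "c \<noteq> 1"
  shows "along ([:1, 1 + c:] ^ (2 ^ k + 1)) ([:1, 1:] ^ (2 ^ k + 1)) (phi t) = 0"
proof -
  have char: "CHAR('f) = 2"
    using CHAR_eq_2_if_even_card[where ?'f = 'f] \<open>k > 0\<close> card by simp
  have two: "u + u = 0" for u :: "'f poly"
    using char by (intro add_self_CHAR_2) simp
  have two': "u + u = 0" for u :: 'f
    using char by (rule add_self_CHAR_2)
  have sum_0: "u = v" if "u + v = 0" for u v :: "'f poly"
    using that two by (metis add_right_cancel)
  define U where "U = [:1, 1 + c:] ^ (2 ^ k + 1)"
  define V where "V = [:1, 1 :: 'f:] ^ (2 ^ k + 1)"
  define W where "W = [:1, c:] ^ (2 ^ k + 1)"
  have ck: "c ^ (2 ^ k) = c"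
    using power_card_field[of c] card by simp
  have c3k: "c ^ (2 ^ (3 * k)) = c"
  proof -
    have "(2 :: nat) ^ (3 * k) = 2 ^ k * 2 ^ k * 2 ^ k"
      using power_mult[of "2 :: nat" k 3] by (simp only: mult.commute[of 3] power3_eq_cube)
    then show ?thesis by (simp only: power_mult ck)
  qed
  have W: "U + V + 1 = W"
    using kasami_sum_eq_0[OF char ck] unfolding U_def V_def W_def by (rule sum_0)
  have "(2 ^ k + 1) * t = 2 ^ (3 * k) + 1"
    using kasami_exponent(1)[of "2 ^ k"] t by (simp add: power_mult mult.commute)
  then have sum: "U ^ t + V ^ t + 1 + W ^ t = 0"
    using kasami_sum_eq_0[OF char c3k] unfolding U_def V_def W_def by (simp only: flip: power_mult)
  have alongs: "along U V [:[:0, 1:]:] = U" "along U V [:0, 1:] = V"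
    by (simp_all add: along_pCons pcompose_pCons pcompose_1 flip: one_pCons)
  have *: "along U V (phi t) * ((U + V) * (U + 1) * (V + 1)) = 0"
    using arg_cong[OF phi_times_lines[OF char, of t], of "along U V"]
    by (simp only: along_mult along_add along_power along_1 alongs W sum)
  have nz: "U + V \<noteq> 0" "U + 1 \<noteq> 0" "V + 1 \<noteq> 0"
  proof -
    \<comment> \<open>A nontrivial linear factor has a root, so none of its powers is the constant \<open>1\<close>.\<close>
    have root: "\<exists>s. poly ([:1, d:] ^ (2 ^ k + 1)) s = 0" if "d \<noteq> 0" for d :: 'f
      using that by (intro exI[of _ "- (1 / d)"]) simp
    have c1: "1 + c \<noteq> 0" using c two'[of 1] by (metis add_left_cancel)
    have no1: "d = 0" if "[:1, d:] ^ (2 ^ k + 1) = 1" for d :: 'f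
      using root[of d] that by (metis poly_1 zero_neq_one)
    show "U + 1 \<noteq> 0"
      using no1[of "1 + c"] c1 sum_0[of U 1] unfolding U_def by blast
    show "V + 1 \<noteq> 0"
    proof
      assume "V + 1 = 0"
      then have "V = 1" by (rule sum_0)
      from no1[OF this[unfolded V_def]] show False using one_neq_zero by contradiction
    qed
    show "U + V \<noteq> 0"
    proof
      assume "U + V = 0"
      then have "W = 1" using W by simp
      then show False using no1[of c] c unfolding W_def by blast
    qed
  qed
  show ?thesis
    using * nz unfolding U_def[symmetric] V_def[symmetric] by simp
qed

section \<open>Transversality\<close>

lemma eval2_pderiv_x: "eval2 (pderiv_x f) (a, b) = poly (pderiv (poly f [:b:])) a"
proof -
  have "poly (pderiv_x f) [:b:] = pderiv (poly f [:b:])"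
    by (induction f) (simp_all add: pderiv_x_def map_poly_pCons pderiv_add pderiv_smult)
  then show ?thesis by (simp add: eval2_def)
qed

lemma eval2_base_change: "eval2 (base_change f) (to_ac a, to_ac b) = to_ac (eval2 f (a, b))"
proof -
  have *: "poly (map_poly to_ac p) (to_ac a) = to_ac (poly p a)" for p a
    by (induction p) (simp_all add: map_poly_pCons)
  show ?thesis
    by (induction f) (simp_all add: base_change_def eval2_def map_poly_pCons *)
qed

lemma pderiv_map_poly_to_ac: "pderiv (map_poly to_ac p) = map_poly to_ac (pderiv p)"
  by (rule poly_eqI) (simp add: coeff_map_poly coeff_pderiv)

lemma pderiv_x_base_change: "pderiv_x (base_change f) = base_change (pderiv_x f)"
  by (rule poly_eqI) (simp add: pderiv_x_def base_change_def coeff_map_poly pderiv_map_poly_to_ac)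

lemma pderiv_y_base_change: "pderiv_y (base_change f) = base_change (pderiv_y f)"
proof (rule poly_eqI, rule poly_eqI)
  fix n m
  show "Polynomial.coeff (Polynomial.coeff (pderiv_y (base_change f)) n) m
    = Polynomial.coeff (Polynomial.coeff (base_change (pderiv_y f)) n) m"
    by (simp add: pderiv_y_def base_change_def coeff_map_poly coeff_pderiv of_nat_poly)
qed

lemma double_root:
  fixes p :: "'a::field poly"
  assumes "poly p a = 0" and "poly (pderiv p) a = 0"
  shows "[:- a, 1:] ^ 2 dvd p"
proof -
  obtain r where r: "p = [:- a, 1:] * r"
    using assms(1) by (auto simp: poly_eq_0_iff_dvd)
  have "poly r a = 0"
    using assms(2) unfolding r pderiv_mult by (simp add: pderiv_pCons)
  then show ?thesis
    unfolding r power2_eq_square by (intro mult_dvd_mono) (simp_all only: poly_eq_0_iff_dvd dvd_refl)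
qed

text \<open>
  The dividend is \<open>(1 + x ^ (q - 1)) ^ q\<close> with \<open>q = 2 ^ k\<close>, and \<open>1\<close> is only a simple zero of
  \<open>1 + x ^ (q - 1)\<close> because \<open>q - 1\<close> is odd.
\<close>

lemma not_dvd_Frobenius_power_binomial:
  assumes "CHAR('a::field) = 2" and "k > 0"
  shows "\<not> [:1, 1:] ^ (2 ^ k + 1) dvd (1 + [:0, 1:] ^ ((2 ^ k - 1) * 2 ^ k) :: 'a poly)"
proof
  let ?x = "[:0, 1:] :: 'a poly"
  have minus: "u - v = u + v" for u v :: "'a poly"
    using assms(1) by (metis minus_CHAR_2 semiring_char_poly)
  have two: "(1 + 1 :: 'a) = 0"
    using assms(1) by (rule add_self_CHAR_2)
  assume dvd: "[:1, 1:] ^ (2 ^ k + 1) dvd (1 + ?x ^ ((2 ^ k - 1) * 2 ^ k))"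
  define R where "R = (\<Sum>i<2 ^ k - 1. ?x ^ i)"
  have "1 + ?x ^ (2 ^ k - 1) = [:1, 1:] * R"
    using power_diff_1_eq[of ?x "2 ^ k - 1"] unfolding R_def minus
    by (simp add: one_pCons add.commute)
  moreover have "1 + ?x ^ ((2 ^ k - 1) * 2 ^ k) = (1 + ?x ^ (2 ^ k - 1)) ^ (2 ^ k)"
    using freshmans_dream'[where ?'a = "'a poly" and x = 1 and m = "2 ^ k" and n = k
        and y = "?x ^ (2 ^ k - 1)"] assms(1)
    by (simp flip: power_mult)
  ultimately have "[:1, 1:] ^ (2 ^ k) * [:1, 1:] dvd [:1, 1:] ^ (2 ^ k) * R ^ (2 ^ k)"
    using dvd by (simp only: power_mult_distrib power_add power_one_right)
  then have "[:1, 1:] dvd R ^ (2 ^ k)"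
    by (subst (asm) dvd_mult_cancel_left) simp
  then obtain S where "R ^ (2 ^ k) = [:1, 1:] * S" by blast
  then have "poly (R ^ (2 ^ k)) 1 = (1 + 1) * poly S 1"
    by (simp only: poly_mult) simp
  then have "poly (R ^ (2 ^ k)) 1 = 0" by (simp only: two mult_zero_left)
  then have "(of_nat (2 ^ k - 1) :: 'a) = 0"
    by (simp add: R_def poly_sum)
  then have "2 dvd (2 :: nat) ^ k - 1"
    using assms(1) by (simp only: of_nat_eq_0_iff_char_dvd)
  then show False using assms(2) by simp
qed

theorem theorem4:
  fixes P :: "'f::{field, finite} \<Rightarrow> 'f poly poly"
    and k t :: nat
  assumes "k > 0"
    and "card (UNIV :: 'f set) = 2 ^ k"
    and "t = 2 ^ (2 * k) - 2 ^ k + 1"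
    and "(phi t :: 'f poly poly) = (\<Prod>\<alpha>\<in>UNIV - {0, 1}. P \<alpha>)"
    and "\<And>\<alpha>. \<alpha> \<in> UNIV - {0, 1} \<Longrightarrow> absolutely_irreducible (P \<alpha>)"
    and "\<And>\<alpha>. \<alpha> \<in> UNIV - {0, 1} \<Longrightarrow> total_degree (P \<alpha>) = 2 ^ k + 1"
    and "\<And>\<alpha>. \<alpha> \<in> UNIV - {0, 1} \<Longrightarrow> poly (P \<alpha>) 0 = [:\<alpha>, 1:] ^ (2 ^ k + 1)"
  shows "intersect_transversally (UNIV - {0, 1}) (\<lambda>\<alpha>. base_change (P \<alpha>)) (1, 1)"
proof -
  let ?I = "UNIV - {0, 1 :: 'f}"
  have char: "CHAR('f) = 2"
    using CHAR_eq_2_if_even_card[where ?'f = 'f] assms(1,2) by simp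
  have two: "u + u = 0" for u :: 'f
    using char by (rule add_self_CHAR_2)
  have sum_0: "u = v" if "u + v = 0" for u v :: 'f
    using that two by (metis add_right_cancel)
  have power_q: "c ^ (2 ^ k) = c" for c :: 'f
    using power_card_field[of c] assms(2) by simp
  define root where "root \<alpha> = (SOME c. \<alpha> = c ^ 2)" for \<alpha> :: 'f
  have root: "root \<alpha> ^ 2 = \<alpha>" for \<alpha>
    unfolding root_def by (rule someI_ex[OF square_root_exists_CHAR_2[OF char], symmetric])

  define U where "U \<alpha> = [:1, 1 + root \<alpha>:] ^ (2 ^ k + 1)" for \<alpha>
  define V where "V = [:1, 1 :: 'f:] ^ (2 ^ k + 1)"
  have on_curve: "along (U \<alpha>) V (P \<alpha>) = 0" if \<alpha>: "\<alpha> \<in> ?I" for \<alpha>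
  proof -
    have "root \<alpha> \<noteq> 0" "root \<alpha> \<noteq> 1" using \<alpha> root[of \<alpha>] by auto
    then have "(\<Prod>\<beta>\<in>?I. along (U \<alpha>) V (P \<beta>)) = 0"
      using phi_along_curve[OF assms(1-3), of "root \<alpha>"]
      unfolding assms(4) U_def V_def along_prod by blast
    then obtain \<beta> where \<beta>: "\<beta> \<in> ?I" "along (U \<alpha>) V (P \<beta>) = 0"
      by auto
    \<comment> \<open>The point at \<open>s = 1\<close> identifies which component contains the curve.\<close>
    have "poly (U \<alpha>) 1 = \<alpha>"
    proof -
      have "1 + (1 + root \<alpha>) = root \<alpha>" by (simp add: two flip: add.assoc del: one_add_one)
      moreover have "poly [:1, 1 + root \<alpha>:] 1 = 1 + (1 + root \<alpha>)" by simp
      ultimately have "poly (U \<alpha>) 1 = root \<alpha> ^ (2 ^ k + 1)" by (simp only: U_def poly_power)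
      then show ?thesis using root[of \<alpha>] by (simp add: power_q power2_eq_square)
    qed
    moreover have "poly V 1 = 0" using two[of 1] by (simp add: V_def)
    ultimately have "eval2 (P \<beta>) (\<alpha>, 0) = 0"
      using poly_along[of "U \<alpha>" V "P \<beta>" 1] \<beta>(2) by simp
    moreover have "eval2 (P \<beta>) (\<alpha>, 0) = (\<beta> + \<alpha>) ^ (2 ^ k + 1)"
      by (simp only: eval2_def prod.case pCons_0_0 assms(7)[OF \<beta>(1)] poly_power) simp
    ultimately have "\<beta> + \<alpha> = 0" by (simp only: power_eq_0_iff)
    then have "\<beta> = \<alpha>" by (rule sum_0)
    then show ?thesis using \<beta>(2) by simp
  qed
  have vanish: "eval2 (P \<alpha>) (1, 1) = 0" if "\<alpha> \<in> ?I" for \<alpha>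
    using poly_along[of "U \<alpha>" V "P \<alpha>" 0] on_curve[OF that] by (simp add: U_def V_def)

  define A where "A \<alpha> = eval2 (pderiv_x (P \<alpha>)) (1, 1)" for \<alpha>
  define B where "B \<alpha> = eval2 (pderiv_y (P \<alpha>)) (1, 1)" for \<alpha>
  have slope: "A \<alpha> * (1 + root \<alpha>) + B \<alpha> = 0" if "\<alpha> \<in> ?I" for \<alpha>
  proof -
    have q: "of_nat (2 ^ k + 1) = (1 :: 'f)"
      using two[of 1] \<open>k > 0\<close> by simp
    have d: "poly (pderiv ([:1, c:] ^ (2 ^ k + 1))) 0 = c" for c :: 'f
      by (simp only: pderiv_power q) (simp add: pderiv_pCons)
    have v: "poly ([:1, c:] ^ (2 ^ k + 1)) 0 = 1" for c :: 'f
      by simp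
    have "poly (U \<alpha>) 0 = 1" "poly V 0 = 1"
      and "poly (pderiv (U \<alpha>)) 0 = 1 + root \<alpha>" "poly (pderiv V) 0 = 1"
      unfolding U_def V_def by (rule v d)+
    then show ?thesis
      using arg_cong[OF pderiv_along[of "U \<alpha>" V "P \<alpha>"], of "\<lambda>p. poly p 0"]
      by (simp add: on_curve[OF that] poly_along A_def B_def)
  qed
  have A_nz: "A \<alpha> \<noteq> 0" if \<alpha>: "\<alpha> \<in> ?I" for \<alpha>
  proof
    \<comment> \<open>Otherwise \<open>x = 1\<close> is a double root of \<open>P \<alpha>\<close> on the line \<open>y = 1\<close>. With one root from each of
      the other \<open>q - 3\<close> components and the square of \<open>x + 1\<close> from \<open>phi_line_y_1\<close> this makes
      \<open>2 + (q - 3) + 2 = q + 1\<close> roots, one too many.\<close>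
    assume A0: "A \<alpha> = 0"
    define p where "p \<beta> = poly (P \<beta>) 1" for \<beta>
    have m1: "[:- 1, 1:] = [:1, 1 :: 'f:]" using char by (simp add: uminus_CHAR_2)
    have p0: "poly (p \<beta>) 1 = 0" if "\<beta> \<in> ?I" for \<beta>
      using vanish[OF that] by (simp add: p_def eval2_def one_pCons)
    have "poly (pderiv (p \<alpha>)) 1 = 0"
      using A0 by (simp add: A_def p_def eval2_pderiv_x one_pCons)
    then have "[:1, 1:] ^ 2 dvd p \<alpha>"
      using double_root[of "p \<alpha>" 1] p0[OF \<alpha>] m1 by simp
    moreover have "(\<Prod>\<beta>\<in>?I - {\<alpha>}. [:1, 1:]) dvd (\<Prod>\<beta>\<in>?I - {\<alpha>}. p \<beta>)"
      using p0 m1 by (intro prod_dvd_prod) (auto simp: poly_eq_0_iff_dvd)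
    ultimately have "[:1, 1:] ^ 2 * [:1, 1:] ^ card (?I - {\<alpha>}) dvd p \<alpha> * (\<Prod>\<beta>\<in>?I - {\<alpha>}. p \<beta>)"
      by (intro mult_dvd_mono) simp_all
    also have "p \<alpha> * (\<Prod>\<beta>\<in>?I - {\<alpha>}. p \<beta>) = poly (phi t) 1"
      using \<alpha> by (simp add: assms(4) poly_prod p_def prod.remove[of ?I \<alpha>])
    finally have "[:1, 1:] ^ 2 * [:1, 1:] ^ card (?I - {\<alpha>}) * [:1, 1:] ^ 2 dvd poly (phi t) 1 * [:1, 1 :: 'f:] ^ 2"
      by (rule mult_dvd_mono) simp
    also have "[:1, 1 :: 'f:] ^ 2 * [:1, 1:] ^ card (?I - {\<alpha>}) * [:1, 1:] ^ 2 = [:1, 1:] ^ (2 ^ k + 1)"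
    proof -
      have "card {0, 1, \<alpha>} = 3" using \<alpha> by auto
      moreover have "?I - {\<alpha>} = UNIV - {0, 1, \<alpha>}" by auto
      moreover have "card {0, 1, \<alpha>} \<le> card (UNIV :: 'f set)" by (rule card_mono) auto
      ultimately have "2 + card (?I - {\<alpha>}) + 2 = 2 ^ k + 1"
        using assms(2) by (simp add: card_Diff_subset)
      then show ?thesis by (simp only: flip: power_add)
    qed
    also have "poly (phi t) 1 * [:1, 1 :: 'f:] ^ 2 = 1 + [:0, 1:] ^ ((2 ^ k - 1) * 2 ^ k)"
    proof -
      have t1: "t - 1 = (2 ^ k - 1) * 2 ^ k"
        using kasami_exponent(2)[of "2 ^ k"] assms(3) by (simp add: power_mult mult.commute)
      then have "odd t" using \<open>k > 0\<close> assms(3) by simp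
      then show ?thesis using phi_line_y_1[OF char, of t] t1 by simp
    qed
    finally show False using not_dvd_Frobenius_power_binomial[OF char \<open>k > 0\<close>] by blast
  qed

  have at_1: "eval2 (base_change f) (1, 1) = to_ac (eval2 f (1, 1))" for f :: "'f poly poly"
    using eval2_base_change[of f 1 1] by simp
  have tangent: "tangent_line (base_change (P \<alpha>)) (1, 1)
      = {(u, v). to_ac (A \<alpha>) * (u - 1) + to_ac (B \<alpha>) * (v - 1) = 0}" for \<alpha>
    by (simp add: tangent_line_def pderiv_x_base_change pderiv_y_base_change at_1 A_def B_def)
  \<comment> \<open>Directions are scaled to second coordinate \<open>1\<close>, so that the line determines \<open>root \<alpha>\<close>.\<close>
  have direction: "(1 + to_ac c, 1 + 1) \<in> tangent_line (base_change (P \<alpha>)) (1, 1) \<longleftrightarrow> c = 1 + root \<alpha>"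
    if "\<alpha> \<in> ?I" for \<alpha> c
  proof -
    have "(1 + to_ac c, 1 + 1) \<in> tangent_line (base_change (P \<alpha>)) (1, 1) \<longleftrightarrow> to_ac (A \<alpha> * c + B \<alpha>) = 0"
      by (simp add: tangent)
    also have "\<dots> \<longleftrightarrow> A \<alpha> * c + B \<alpha> = A \<alpha> * (1 + root \<alpha>) + B \<alpha>"
      unfolding slope[OF that] by (rule to_ac_eq_0_iff)
    also have "\<dots> \<longleftrightarrow> c = 1 + root \<alpha>"
      using A_nz[OF that] by (simp only: add_right_cancel mult_cancel_left) simp
    finally show ?thesis .
  qed
  show ?thesis
    unfolding intersect_transversally_def
  proof (intro conjI ballI impI)
    fix \<alpha> assume \<alpha>: "\<alpha> \<in> ?I"
    show "simple_point (base_change (P \<alpha>)) (1, 1)"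
      using vanish[OF \<alpha>] A_nz[OF \<alpha>]
      by (simp add: simple_point_def at_1 pderiv_x_base_change A_def)
  next
    fix \<alpha> \<beta> assume \<alpha>\<beta>: "\<alpha> \<in> ?I" "\<beta> \<in> ?I" "\<alpha> \<noteq> \<beta>"
    show "tangent_line (base_change (P \<alpha>)) (1, 1) \<noteq> tangent_line (base_change (P \<beta>)) (1, 1)"
    proof
      assume "tangent_line (base_change (P \<alpha>)) (1, 1) = tangent_line (base_change (P \<beta>)) (1, 1)"
      then have "root \<alpha> = root \<beta>"
        using direction[OF \<alpha>\<beta>(1), of "1 + root \<alpha>"] direction[OF \<alpha>\<beta>(2), of "1 + root \<alpha>"] by simp
      then show False using root \<alpha>\<beta>(3) by metis
    qed
  qed
qed

end
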